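(* Let $Z=\operatorname{diag}(Z_1,\dots,Z_m)$ be an $n\times n$ block-diagonal doubly stochastic projection, where for each $i$ the block $Z_i$ is of size $d_i\times d_i$, $Z_i=\operatorname{diag}(U_{k_i},\dots,U_{k_i})$ with $s_i=d_i/k_i$ copies of $U_{k_i}$, and the positive integers $k_1,\dots,k_m$ are pairwise different. Let $A=\operatorname{diag}(A_1,\dots,A_m)$ be an $n\times n$ permutation matrix, with $A_i$ of size $d_i\times d_i$, which commutes with $Z$. For an arbitrary doubly stochastic $n\times n$ matrix $X$, the following statements are equivalent: (a) $AXA=XAX$ and $\mathcal N(X)=\mathcal N(Z)$. (b) There exist permutation matrices $Q_1,\dots,Q_m$, with $Q_i$ of size $d_i\times d_i$, such that $X=\operatorname{diag}(Z_1Q_1,\dots,Z_mQ_m)$ and, for each $i\in\{1,\dots,m\}$, $Q_iZ_i=Z_iQ_i$ and $$(A_iQ_iA_i)\upharpoonright_{\mathcal R(Z_i)}=(Q_iA_iQ_i)\upharpoonright_{\mathcal R(Z_i)}.$$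
   Context: All matrices are real. A doubly stochastic matrix is a square matrix with nonnegative entries, all of whose row sums and column sums equal $1$. $U_k$ is the $k\times k$ matrix all of whose entries equal $1/k$. $\mathcal N(\cdot)$ and $\mathcal R(\cdot)$ denote the null space and the range (column space), and $M\upharpoonright_V$ denotes the restriction of the linear map $M$ to the subspace $V$. *)

theory Defs
  imports
    "Jordan_Normal_Form.Matrix_Kernel"
    "HOL-Combinatorics.Permutations"
    "HOL-Library.FuncSet"
begin

definition doubly_stochastic :: "nat \<Rightarrow> real mat \<Rightarrow> bool" where
  "doubly_stochastic n X \<longleftrightarrow>
     X \<in> carrier_mat n n \<and>
     (\<forall>i<n. \<forall>j<n. 0 \<le> X $$ (i, j)) \<and>
     (\<forall>i<n. (\<Sum>j<n. X $$ (i, j)) = 1) \<and>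
     (\<forall>j<n. (\<Sum>i<n. X $$ (i, j)) = 1)"

definition projection_mat :: "nat \<Rightarrow> real mat \<Rightarrow> bool" where
  "projection_mat n Z \<longleftrightarrow> Z \<in> carrier_mat n n \<and> Z * Z = Z"

definition permutation_mat :: "nat \<Rightarrow> real mat \<Rightarrow> bool" where
  "permutation_mat n P \<longleftrightarrow>
     (\<exists>p. p permutes {..<n} \<and> P = mat n n (\<lambda>(i, j). if j = p i then 1 else 0))"

definition unif_mat :: "nat \<Rightarrow> real mat" where
  "unif_mat k = mat k k (\<lambda>_. 1 / real k)"

(* The blocks are indexed from 1: bdiag m B = diag(B 1, ..., B m). *)
definition bdiag :: "nat \<Rightarrow> (nat \<Rightarrow> real mat) \<Rightarrow> real mat" where
  "bdiag m B = diag_block_mat (map B [1..<Suc m])"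

definition range_space :: "real mat \<Rightarrow> real vec set" where
  "range_space M = vec_space.col_space (dim_row M) M"

lemma range_space_eq:
  "range_space M = (\<lambda>v. M *\<^sub>v v) ` carrier_vec (dim_col M)"
proof -
  have M: "M \<in> carrier_mat (dim_row M) (dim_col M)" by simp
  have "M *\<^sub>v v \<in> carrier_vec (dim_row M)" if "v \<in> carrier_vec (dim_col M)" for v
    using mult_mat_vec_carrier[OF M that] .
  then show ?thesis
    unfolding range_space_def vec_space.col_space_eq[OF M] by blast
qed

definition restr :: "real mat \<Rightarrow> real vec set \<Rightarrow> real vec \<Rightarrow> real vec" where
  "restr M V = restrict (\<lambda>v. M *\<^sub>v v) V"

end

theory Submission
  imports Defs "HOL-Combinatorics.Cycles"
begin

text \<open>
  Write \<open>Z\<close> for the given projection; it is symmetric, so it is the orthogonal projection onto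
  the vectors that are constant on cells, where the cells are the index sets of the individual blocks
  \<open>U\<^sub>k\<close>.

  Suppose \<open>AXA = XAX\<close> and that \<open>X\<close> and \<open>Z\<close> have the same kernel. The
  braid relation conjugates \<open>A\<close> into \<open>X\<close>, in the form
  \<open>A (XA) = (XA) X\<close>. A permutation matrix has finite order \<open>N\<close>, and hence
  \<open>X\<^sup>N\<close> acts as the identity modulo the kernel, that is,
  \<open>Z X\<^sup>N = Z\<close>. A doubly stochastic matrix does not increase the Euclidean norm, and a
  contraction cannot lose any length if a power of it brings every vector back. This gives
  \<open>X\<^sup>T X = X X\<^sup>T = Z\<close> and \<open>XZ = ZX = X\<close> (lemma \<open>braid_isometry\<close>).

  The rest is combinatorial. A nonnegative matrix with these properties has no two overlapping rows or
  columns from different cells, so it matches cells with cells, and comparing the row sums with the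
  row norms shows that matched cells have the same size (lemma \<open>isometry_entry\<close>). Cells of
  equal size lie in the same block \<open>Z\<^sub>i\<close> because the \<open>k\<^sub>i\<close> are distinct,
  so \<open>X\<close> is block diagonal. Within a block, the matching of cells extends to a permutation of
  indices, which gives \<open>Q\<^sub>i\<close> (lemma \<open>cell_constant_eq_unif_perm\<close>).

  Finally, for \<open>X = diag(Z\<^sub>i Q\<^sub>i)\<close> with \<open>Q\<^sub>i\<close> commuting with
  \<open>Z\<^sub>i\<close>, the relation \<open>AXA = XAX\<close> can be tested block by block, and there it is
  the stated identity on the range of \<open>Z\<^sub>i\<close> (lemma \<open>braid_blocks_iff\<close>). This
  settles the last part of the forward direction as well as the braid relation in the converse; in the
  converse the kernels agree because \<open>X\<close> is an invertible matrix times \<open>Z\<close>.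
\<close>

section \<open>Quadratic forms, contractions and kernels\<close>

lemma mult_unit_vec:
  fixes M :: "real mat"
  assumes "M \<in> carrier_mat n n" "j < n"
  shows "M *\<^sub>v unit_vec n j = col M j"
  using assms by (intro eq_vecI) (auto simp: mult_mat_vec_def)

lemma mat_eq_by_vecs:
  fixes M N :: "real mat"
  assumes M: "M \<in> carrier_mat n n" and N: "N \<in> carrier_mat n n"
    and eq: "\<And>v. v \<in> carrier_vec n \<Longrightarrow> M *\<^sub>v v = N *\<^sub>v v"
  shows "M = N"
proof (rule eq_matI)
  fix i j assume "i < dim_row N" "j < dim_col N"
  then have i: "i < n" and j: "j < n" using N by auto
  have "col M j = col N j"
    using eq[of "unit_vec n j"] mult_unit_vec[OF M j] mult_unit_vec[OF N j] by simp
  then have "col M j $ i = col N j $ i" by simp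
  then show "M $$ (i, j) = N $$ (i, j)" using M N i j by simp
qed (use M N in auto)

text \<open>
  Polarization: a symmetric matrix is read off from its quadratic form at the unit vectors and at
  sums of two of them.
\<close>

lemma quadratic_form_unique:
  fixes M N :: "real mat"
  assumes M: "M \<in> carrier_mat n n" "transpose_mat M = M"
    and N: "N \<in> carrier_mat n n" "transpose_mat N = N"
    and eq: "\<And>v. v \<in> carrier_vec n \<Longrightarrow> v \<bullet> (M *\<^sub>v v) = v \<bullet> (N *\<^sub>v v)"
  shows "M = N"
proof (rule eq_matI)
  fix i j assume "i < dim_row N" "j < dim_col N"
  then have i: "i < n" and j: "j < n" using N by auto
  have entry: "unit_vec n a \<bullet> (P *\<^sub>v unit_vec n b) = P $$ (a, b)"
    if "P \<in> carrier_mat n n" "a < n" "b < n" for P :: "real mat" and a b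
    using that mult_unit_vec[of P n b] by simp
  have polar: "(unit_vec n i + unit_vec n j) \<bullet> (P *\<^sub>v (unit_vec n i + unit_vec n j))
      = P $$ (i, i) + P $$ (i, j) + P $$ (j, i) + P $$ (j, j)"
    if P: "P \<in> carrier_mat n n" for P :: "real mat"
  proof -
    have "P *\<^sub>v (unit_vec n i + unit_vec n j) = P *\<^sub>v unit_vec n i + P *\<^sub>v unit_vec n j"
      by (rule mult_add_distrib_mat_vec[OF P]) auto
    then show ?thesis
      using P i j entry[OF P]
      by (simp add: add_scalar_prod_distrib[of _ n] scalar_prod_add_distrib[of _ n])
  qed
  have sym: "P $$ (j, i) = P $$ (i, j)"
    if "P \<in> carrier_mat n n" "transpose_mat P = P" for P :: "real mat"
  proof -
    have "transpose_mat P $$ (i, j) = P $$ (j, i)" using that(1) i j by simp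
    then show ?thesis using that(2) by simp
  qed
  have "M $$ (i, i) = N $$ (i, i)" "M $$ (j, j) = N $$ (j, j)"
    using eq[of "unit_vec n i"] eq[of "unit_vec n j"] entry[OF M(1)] entry[OF N(1)] i j
    by simp_all
  moreover have "M $$ (i, i) + M $$ (i, j) + M $$ (j, i) + M $$ (j, j)
      = N $$ (i, i) + N $$ (i, j) + N $$ (j, i) + N $$ (j, j)"
    using eq[of "unit_vec n i + unit_vec n j"] polar[OF M(1)] polar[OF N(1)] by simp
  ultimately show "M $$ (i, j) = N $$ (i, j)"
    using sym[OF M] sym[OF N] by linarith
qed (use M N in auto)

lemma scalar_prod_self_sum:
  fixes w :: "real vec"
  assumes "w \<in> carrier_vec n"
  shows "w \<bullet> w = (\<Sum>i<n. (w $ i)\<^sup>2)"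
  using assms by (simp add: scalar_prod_def power2_eq_square atLeast0LessThan)

text \<open>
  Jensen's inequality with the weights in a row of \<open>X\<close> bounds the square of each entry of
  \<open>X v\<close> by the weighted mean of the squares of the entries of \<open>v\<close>; since the
  columns of \<open>X\<close> sum to 1 as well, summing over the rows gives back the squared norm of
  \<open>v\<close>.
\<close>

lemma doubly_stochastic_contraction:
  assumes X: "doubly_stochastic n X" and v: "v \<in> carrier_vec n"
  shows "(X *\<^sub>v v) \<bullet> (X *\<^sub>v v) \<le> v \<bullet> v"
proof -
  have Xc: "X \<in> carrier_mat n n" and nn: "\<And>i j. i < n \<Longrightarrow> j < n \<Longrightarrow> 0 \<le> X $$ (i, j)"
    and row: "\<And>i. i < n \<Longrightarrow> (\<Sum>j<n. X $$ (i, j)) = 1"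
    and col: "\<And>j. j < n \<Longrightarrow> (\<Sum>i<n. X $$ (i, j)) = 1"
    using X by (auto simp: doubly_stochastic_def)
  have jensen: "((X *\<^sub>v v) $ i)\<^sup>2 \<le> (\<Sum>j<n. X $$ (i, j) * (v $ j)\<^sup>2)" if i: "i < n" for i
  proof -
    \<comment> \<open>Jensen's inequality is the nonnegativity of the variance about the weighted mean \<open>m\<close>.\<close>
    define m where "m = (X *\<^sub>v v) $ i"
    have m: "m = (\<Sum>j<n. X $$ (i, j) * v $ j)"
      unfolding m_def using Xc v i by (simp add: scalar_prod_def atLeast0LessThan)
    have "0 \<le> (\<Sum>j<n. X $$ (i, j) * (v $ j - m)\<^sup>2)"
      using nn i by (intro sum_nonneg mult_nonneg_nonneg) auto
    also have "\<dots> = (\<Sum>j<n. X $$ (i, j) * (v $ j)\<^sup>2 - 2 * m * (X $$ (i, j) * v $ j)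
        + m\<^sup>2 * X $$ (i, j))"
      by (rule sum.cong) (auto simp: power2_eq_square algebra_simps)
    also have "\<dots> = (\<Sum>j<n. X $$ (i, j) * (v $ j)\<^sup>2) - 2 * m * m + m\<^sup>2 * 1"
      by (simp only: sum.distrib sum_subtractf flip: sum_distrib_left)
         (simp only: row[OF i] flip: m)
    finally show ?thesis unfolding m_def by (simp add: power2_eq_square)
  qed
  have "(X *\<^sub>v v) \<bullet> (X *\<^sub>v v) = (\<Sum>i<n. ((X *\<^sub>v v) $ i)\<^sup>2)"
    using scalar_prod_self_sum Xc v by (metis mult_mat_vec_carrier)
  also have "\<dots> \<le> (\<Sum>i<n. \<Sum>j<n. X $$ (i, j) * (v $ j)\<^sup>2)"
    by (rule sum_mono) (use jensen in auto)
  also have "\<dots> = (\<Sum>j<n. (\<Sum>i<n. X $$ (i, j)) * (v $ j)\<^sup>2)"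
    by (subst sum.swap) (simp add: sum_distrib_right)
  also have "\<dots> = v \<bullet> v" using col scalar_prod_self_sum[OF v] by simp
  finally show ?thesis .
qed

lemma doubly_stochastic_pow_contraction:
  assumes X: "doubly_stochastic n X" and v: "v \<in> carrier_vec n"
  shows "(X ^\<^sub>m k *\<^sub>v v) \<bullet> (X ^\<^sub>m k *\<^sub>v v) \<le> v \<bullet> v"
  using v
proof (induction k arbitrary: v)
  case 0
  have "dim_row X = n" using X by (auto simp: doubly_stochastic_def)
  then show ?case using 0 by simp
next
  case (Suc k)
  have Xc: "X \<in> carrier_mat n n" using X by (simp add: doubly_stochastic_def)
  have "X ^\<^sub>m Suc k *\<^sub>v v = X ^\<^sub>m k *\<^sub>v (X *\<^sub>v v)"
    using assoc_mult_mat_vec[OF pow_carrier_mat[OF Xc] Xc Suc.prems] by simp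
  then show ?case
    using Suc.IH[of "X *\<^sub>v v"] doubly_stochastic_contraction[OF X Suc.prems]
      mult_mat_vec_carrier[OF Xc Suc.prems] by simp
qed

lemma sym_projection_pythagoras:
  fixes Z :: "real mat"
  assumes Z: "Z \<in> carrier_mat n n" and sym: "transpose_mat Z = Z" and idem: "Z * Z = Z"
    and w: "w \<in> carrier_vec n"
  shows "w \<bullet> (Z *\<^sub>v w) = (Z *\<^sub>v w) \<bullet> (Z *\<^sub>v w)"
proof -
  have c: "Z *\<^sub>v w \<in> carrier_vec n" using mult_mat_vec_carrier[OF Z w] .
  have "w \<bullet> (Z *\<^sub>v w) = w \<bullet> (Z *\<^sub>v (Z *\<^sub>v w))"
    using assoc_mult_mat_vec[OF Z Z w] idem by simp
  also have "\<dots> = (Z *\<^sub>v w) \<bullet> (Z *\<^sub>v w)"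
    using transpose_vec_mult_scalar[OF Z c w] sym by simp
  finally show ?thesis .
qed

text \<open>
  By Pythagoras, \<open>w - Z w\<close> has squared norm \<open>w \<bullet> w - Z w \<bullet> Z w\<close>, so an
  orthogonal projection shortens every vector outside its range.
\<close>

lemma sym_projection_fixed_if_norm_kept:
  fixes Z :: "real mat"
  assumes Z: "Z \<in> carrier_mat n n" and sym: "transpose_mat Z = Z" and idem: "Z * Z = Z"
    and w: "w \<in> carrier_vec n" and le: "w \<bullet> w \<le> (Z *\<^sub>v w) \<bullet> (Z *\<^sub>v w)"
  shows "Z *\<^sub>v w = w"
proof -
  let ?z = "Z *\<^sub>v w"
  have c: "?z \<in> carrier_vec n" using mult_mat_vec_carrier[OF Z w] .
  have "(w - ?z) \<bullet> (w - ?z) = w \<bullet> w - ?z \<bullet> ?z"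
    using sym_projection_pythagoras[OF Z sym idem w] comm_scalar_prod[OF w c] w c
    by (simp add: minus_scalar_prod_distrib[of _ n] scalar_prod_minus_distrib[of _ n])
  then have "(\<Sum>i<n. ((w - ?z) $ i)\<^sup>2) \<le> 0"
    using le scalar_prod_self_sum[of "w - ?z" n] w c by simp
  then have "(\<Sum>i<n. ((w - ?z) $ i)\<^sup>2) = 0"
    using sum_nonneg[of "{..<n}" "\<lambda>i. ((w - ?z) $ i)\<^sup>2"] by simp
  then have "\<forall>i\<in>{..<n}. ((w - ?z) $ i)\<^sup>2 = 0"
    by (subst (asm) sum_nonneg_eq_0_iff) auto
  then show ?thesis using w c Z by (intro eq_vecI) auto
qed

section \<open>The braid relation makes a matrix of finite order an isometry\<close>

text \<open>
  Matrix powers follow the iterates of the permutation, and a permutation of a finite set has finite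
  order. This also provides left inverses of permutation matrices.
\<close>

lemma permutation_mat_finite_order:
  assumes "permutation_mat n P"
  shows "\<exists>N>0. P ^\<^sub>m N = 1\<^sub>m n"
proof -
  obtain p where p: "p permutes {..<n}"
    and P: "P = mat n n (\<lambda>(i, j). if j = p i then 1 else 0)"
    using assms by (auto simp: permutation_mat_def)
  have pw: "P ^\<^sub>m k = mat n n (\<lambda>(i, j). if j = (p ^^ k) i then 1 else 0)" for k
  proof (induction k)
    case 0
    show ?case unfolding P by (intro eq_matI) auto
  next
    case (Suc k)
    have "(\<Sum>l<n. (if l = (p ^^ k) i then 1 else 0) * (if j = p l then 1 else 0))
        = (if j = p ((p ^^ k) i) then 1 else (0::real))" if "i < n" for i j
    proof -
      have "(p ^^ k) i < n"
        using permutes_in_image[OF permutes_funpow[OF p, of k], of i] that by simp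
      then show ?thesis by (simp add: if_distrib[of "\<lambda>x. x * _"] cong: if_cong)
    qed
    then show ?case
      unfolding pow_mat.simps Suc unfolding P
      by (intro eq_matI) (auto simp: scalar_prod_def atLeast0LessThan)
  qed
  obtain N where "p ^^ N = id" "N > 0"
    using permutation_is_nilpotent p permutation_permutes by (metis finite_lessThan)
  then show ?thesis using pw[of N] by (intro exI[of _ N]) auto
qed

text \<open>
  This is how the hypothesis on null spaces enters: in an equation, a left factor may be replaced by
  any matrix whose kernel is at least as large.
\<close>

lemma kernel_cancel:
  fixes X Z B C :: "real mat"
  assumes X: "X \<in> carrier_mat n n" and Z: "Z \<in> carrier_mat n n"
    and B: "B \<in> carrier_mat n n" and C: "C \<in> carrier_mat n n"
    and ker: "mat_kernel X \<subseteq> mat_kernel Z" and eq: "X * B = X * C"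
  shows "Z * B = Z * C"
proof (rule mat_eq_by_vecs[of _ n])
  fix v :: "real vec" assume v: "v \<in> carrier_vec n"
  have Bv: "B *\<^sub>v v \<in> carrier_vec n" and Cv: "C *\<^sub>v v \<in> carrier_vec n"
    using B C v by auto
  have "X *\<^sub>v (B *\<^sub>v v) = X *\<^sub>v (C *\<^sub>v v)"
    using eq assoc_mult_mat_vec[OF X B v] assoc_mult_mat_vec[OF X C v] by simp
  then have "X *\<^sub>v (B *\<^sub>v v - C *\<^sub>v v) = 0\<^sub>v n"
    using X Bv Cv by (simp add: mult_minus_distrib_mat_vec[OF X Bv Cv])
  then have "B *\<^sub>v v - C *\<^sub>v v \<in> mat_kernel X"
    using Bv Cv by (intro mat_kernelI[OF X]) auto
  then have "Z *\<^sub>v (B *\<^sub>v v - C *\<^sub>v v) = 0\<^sub>v n"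
    using ker mat_kernelD[OF Z] by auto
  then have zero: "Z *\<^sub>v (B *\<^sub>v v) - Z *\<^sub>v (C *\<^sub>v v) = 0\<^sub>v n"
    by (simp add: mult_minus_distrib_mat_vec[OF Z Bv Cv])
  have "Z *\<^sub>v (B *\<^sub>v v) = Z *\<^sub>v (C *\<^sub>v v)"
  proof (rule eq_vecI)
    fix i assume "i < dim_vec (Z *\<^sub>v (C *\<^sub>v v))"
    then have i: "i < n" using Z by simp
    have "(Z *\<^sub>v (B *\<^sub>v v) - Z *\<^sub>v (C *\<^sub>v v)) $ i = 0" using zero i by simp
    then show "(Z *\<^sub>v (B *\<^sub>v v)) $ i = (Z *\<^sub>v (C *\<^sub>v v)) $ i" using i Z by simp
  qed simp
  then show "Z * B *\<^sub>v v = Z * C *\<^sub>v v"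
    using assoc_mult_mat_vec[OF Z B v] assoc_mult_mat_vec[OF Z C v] by simp
qed (use Z B C in auto)

text \<open>
  The braid relation says \<open>A (X A) = (X A) X\<close>, hence
  \<open>A ^\<^sub>m j * (X * A) = (X * A) * X ^\<^sub>m j\<close> for all \<open>j\<close>. For
  \<open>j = N\<close> the left-hand side is \<open>X A\<close>, and cancelling with the help of the kernels
  and of the invertibility of \<open>A\<close> yields \<open>Z X\<^sup>N = Z\<close>. Now each of
  the inequalities
  \<open>|Z v| = |Z X\<^sup>N v| \<le> |X\<^sup>N v| \<le> |X v| = |X Z v| \<le> |Z v|\<close>
  holds because projections and doubly stochastic matrices are contractions, so all of them are
  equalities. The first one gives \<open>X\<^sup>N = Z\<close>, so that \<open>Z\<close> commutes with
  \<open>X\<close>; the last one shows that \<open>X\<close> is an isometry on the range of \<open>Z\<close>,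
  which is the matrix identity \<open>X\<^sup>T X = Z\<close>.
\<close>

lemma braid_isometry:
  fixes X Z A :: "real mat"
  assumes X: "doubly_stochastic n X"
    and Z: "Z \<in> carrier_mat n n" and sym: "transpose_mat Z = Z" and idem: "Z * Z = Z"
    and A: "A \<in> carrier_mat n n" and comm: "A * Z = Z * A"
    and fin: "A ^\<^sub>m N = 1\<^sub>m n" "0 < N"
    and braid: "A * X * A = X * A * X" and ker: "mat_kernel X = mat_kernel Z"
  shows "X * Z = X" "Z * X = X" "transpose_mat X * X = Z" "X * transpose_mat X = Z"
proof -
  have Xc: "X \<in> carrier_mat n n" using X by (simp add: doubly_stochastic_def)
  note mults = mult_carrier_mat[of _ n n _ n]
  have one: "1\<^sub>m n \<in> carrier_mat n n" by simp
  \<comment> \<open>Cancelling in \<open>Z (Z - 1) = 0\<close> gives \<open>X (Z - 1) = 0\<close>.\<close>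
  show XZ: "X * Z = X"
    using kernel_cancel[OF Z Xc Z one] ker idem Z Xc by simp
  have XA: "X * A \<in> carrier_mat n n" using Xc A by simp
  have twist: "A ^\<^sub>m j * (X * A) = (X * A) * X ^\<^sub>m j" for j
  proof (induction j)
    case 0
    then show ?case using Xc A XA by simp
  next
    case (Suc j)
    have "A ^\<^sub>m Suc j * (X * A) = A ^\<^sub>m j * (A * (X * A))"
      using A XA assoc_mult_mat[OF pow_carrier_mat[OF A] A XA] by simp
    also have "A * (X * A) = (X * A) * X"
      using braid A Xc by simp
    also have "A ^\<^sub>m j * ((X * A) * X) = (A ^\<^sub>m j * (X * A)) * X"
      using assoc_mult_mat[OF pow_carrier_mat[OF A] XA Xc] by simp
    also have "\<dots> = (X * A) * X ^\<^sub>m j * X" using Suc by simp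
    also have "\<dots> = (X * A) * X ^\<^sub>m Suc j"
      using assoc_mult_mat[OF XA pow_carrier_mat[OF Xc] Xc] by simp
    finally show ?case .
  qed
  define Y where "Y = X ^\<^sub>m N"
  have Y: "Y \<in> carrier_mat n n" unfolding Y_def using Xc by simp
  have leftinv: "A ^\<^sub>m (N - 1) * A = 1\<^sub>m n"
    using fin by (cases N) auto
  have cancelA: "B = C" if "A * B = A * C" "B \<in> carrier_mat n n" "C \<in> carrier_mat n n" for B C
  proof -
    have "A ^\<^sub>m (N - 1) * (A * B) = A ^\<^sub>m (N - 1) * (A * C)" using that by simp
    then have "(A ^\<^sub>m (N - 1) * A) * B = (A ^\<^sub>m (N - 1) * A) * C"
      using assoc_mult_mat[OF pow_carrier_mat[OF A] A that(2), of "N - 1"]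
        assoc_mult_mat[OF pow_carrier_mat[OF A] A that(3), of "N - 1"] by simp
    then show ?thesis using leftinv that by simp
  qed
  have "X * A = X * A * Y"
    using twist[of N] unfolding fin(1) Y_def left_mult_one_mat[OF XA] .
  also have "X * A * Y = X * (A * Y)" by (rule assoc_mult_mat[OF Xc A Y])
  finally have "Z * A = Z * (A * Y)"
    by (intro kernel_cancel[OF Xc Z A mults[OF A Y]]) (simp add: ker)
  also have "\<dots> = Z * A * Y" by (rule assoc_mult_mat[OF Z A Y, symmetric])
  finally have "A * Z = A * Z * Y" unfolding comm .
  also have "\<dots> = A * (Z * Y)" by (rule assoc_mult_mat[OF A Z Y])
  finally have ZY: "Z = Z * Y" by (rule cancelA[OF _ Z mults[OF Z Y]])
  have XXm: "X ^\<^sub>m (N - 1) * X = Y"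
    using fin unfolding Y_def by (cases N) auto
  have Yle: "(Y *\<^sub>v v) \<bullet> (Y *\<^sub>v v) \<le> (X *\<^sub>v v) \<bullet> (X *\<^sub>v v)" if v: "v \<in> carrier_vec n" for v
  proof -
    have "Y *\<^sub>v v = X ^\<^sub>m (N - 1) *\<^sub>v (X *\<^sub>v v)"
      using assoc_mult_mat_vec[OF pow_carrier_mat[OF Xc] Xc v] XXm by metis
    then show ?thesis
      using doubly_stochastic_pow_contraction[OF X, of "X *\<^sub>v v"] Xc v by simp
  qed
  have Xle: "(X *\<^sub>v v) \<bullet> (X *\<^sub>v v) \<le> (Z *\<^sub>v v) \<bullet> (Z *\<^sub>v v)" if v: "v \<in> carrier_vec n" for v
  proof -
    have "X *\<^sub>v v = X *\<^sub>v (Z *\<^sub>v v)" using assoc_mult_mat_vec[OF Xc Z v] XZ by simp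
    then show ?thesis using doubly_stochastic_contraction[OF X, of "Z *\<^sub>v v"] Z v by simp
  qed
  have ZYv: "Z *\<^sub>v (Y *\<^sub>v v) = Z *\<^sub>v v" if v: "v \<in> carrier_vec n" for v
    using assoc_mult_mat_vec[OF Z Y v] by (simp flip: ZY)
  have Yv: "Y *\<^sub>v v = Z *\<^sub>v v" if v: "v \<in> carrier_vec n" for v
  proof -
    have c: "Y *\<^sub>v v \<in> carrier_vec n" using Y v by simp
    have "Z *\<^sub>v (Y *\<^sub>v v) = Y *\<^sub>v v"
      by (rule sym_projection_fixed_if_norm_kept[OF Z sym idem c])
         (use Yle[OF v] Xle[OF v] ZYv[OF v] in simp)
    then show ?thesis using ZYv[OF v] by simp
  qed
  have YZ: "Y = Z" by (rule mat_eq_by_vecs[OF Y Z Yv])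
  have pow_comm: "X * X ^\<^sub>m j = X ^\<^sub>m j * X" for j
  proof (induction j)
    case 0 then show ?case using Xc by simp
  next
    case (Suc j)
    then show ?case
      unfolding pow_mat.simps assoc_mult_mat[OF Xc pow_carrier_mat[OF Xc] Xc, symmetric] by simp
  qed
  show ZX: "Z * X = X" using pow_comm[of N] YZ XZ unfolding Y_def by simp
  have XTc: "transpose_mat X \<in> carrier_mat n n" using Xc by simp
  show XTX: "transpose_mat X * X = Z"
  proof (rule quadratic_form_unique[of _ n])
    show "transpose_mat (transpose_mat X * X) = transpose_mat X * X"
      using transpose_mult[OF XTc Xc] by simp
    fix v :: "real vec" assume v: "v \<in> carrier_vec n"
    have Xv: "X *\<^sub>v v \<in> carrier_vec n" using Xc v by simp
    have tXv: "transpose_mat X *\<^sub>v (X *\<^sub>v v) \<in> carrier_vec n" using XTc Xv by simp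
    have "v \<bullet> (transpose_mat X * X *\<^sub>v v) = (transpose_mat X *\<^sub>v (X *\<^sub>v v)) \<bullet> v"
      using assoc_mult_mat_vec[OF XTc Xc v] comm_scalar_prod[OF v tXv] by simp
    also have "\<dots> = (X *\<^sub>v v) \<bullet> (X *\<^sub>v v)"
      by (rule transpose_vec_mult_scalar[OF Xc v Xv])
    also have "\<dots> = (Z *\<^sub>v v) \<bullet> (Z *\<^sub>v v)"
      using Xle[OF v] Yle[OF v] Yv[OF v] by simp
    also have "\<dots> = v \<bullet> (Z *\<^sub>v v)"
      using sym_projection_pythagoras[OF Z sym idem v] by simp
    finally show "v \<bullet> (transpose_mat X * X *\<^sub>v v) = v \<bullet> (Z *\<^sub>v v)" .
  qed (use Xc XTc Z sym in auto)
  \<comment> \<open>On the range of \<open>Z\<close> the inverse of \<open>X\<close> is both \<open>X\<^sup>T\<close> and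
    \<open>X ^\<^sub>m (N - 1)\<close>, which turns the left inverse into a right inverse.\<close>
  have "X * X ^\<^sub>m (N - 1) = Z" using pow_comm XXm YZ by simp
  moreover have "transpose_mat X = transpose_mat X * Z"
    using transpose_mult[OF Z Xc] ZX sym by simp
  ultimately have "X * transpose_mat X = X * (transpose_mat X * (X * X ^\<^sub>m (N - 1)))"
    by simp
  also have "\<dots> = X * Z * X ^\<^sub>m (N - 1)"
    using assoc_mult_mat[OF XTc Xc pow_carrier_mat[OF Xc], of "N - 1"]
      assoc_mult_mat[OF Xc Z pow_carrier_mat[OF Xc], of "N - 1"] XTX by simp
  also have "\<dots> = Z" using XZ \<open>X * X ^\<^sub>m (N - 1) = Z\<close> by simp
  finally show "X * transpose_mat X = Z" .
qed

section \<open>Block-diagonal matrices\<close>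

text \<open>
  The blocks of \<open>bdiag m B\<close> are numbered from 1; \<open>offset d i\<close> is the position of the
  first row of block \<open>i\<close>, and so \<open>offset d (Suc m)\<close> is the size of the whole
  matrix.
\<close>

definition offset :: "(nat \<Rightarrow> nat) \<Rightarrow> nat \<Rightarrow> nat" where
  "offset d i = (\<Sum>j\<in>{1..<i}. d j)"

lemma offset_Suc: "offset d (Suc (Suc m)) = offset d (Suc m) + d (Suc m)"
  unfolding offset_def by (subst sum.atLeastLessThan_Suc) auto

lemma offset_less:
  assumes "i \<in> {1..m}" "y < d i"
  shows "offset d i + y < offset d (Suc m)"
  using assms
proof (induction m)
  case 0 then show ?case by simp
next
  case (Suc m)
  then show ?case
    by (cases "i = Suc m") (auto simp: offset_Suc less_Suc_eq_le intro: trans_less_add1)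
qed

lemma offset_cover:
  assumes "x < offset d (Suc m)"
  obtains i y where "i \<in> {1..m}" "y < d i" "x = offset d i + y"
  using assms
proof (induction m arbitrary: thesis)
  case 0 then show ?case by (simp add: offset_def)
next
  case (Suc m)
  show ?case
  proof (cases "x < offset d (Suc m)")
    case True
    then obtain i y where "i \<in> {1..m}" "y < d i" "x = offset d i + y"
      using Suc.IH by blast
    then show ?thesis by (intro Suc.prems(1)[of i y]) auto
  next
    case False
    then show ?thesis
      using Suc.prems(2) by (intro Suc.prems(1)[of "Suc m" "x - offset d (Suc m)"]) (auto simp: offset_Suc)
  qed
qed

lemma bdiag_0: "bdiag 0 B = 0\<^sub>m 0 0"
  by (simp add: bdiag_def)

lemma bdiag_Suc:
  "bdiag (Suc m) B = four_block_mat (bdiag m B)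
     (0\<^sub>m (dim_row (bdiag m B)) (dim_col (B (Suc m))))
     (0\<^sub>m (dim_row (B (Suc m))) (dim_col (bdiag m B))) (B (Suc m))"
proof -
  have "[1..<Suc (Suc m)] = [1..<Suc m] @ [Suc m]" by simp
  then show ?thesis
    unfolding bdiag_def by (simp only: map_append list.map diag_block_mat_last Let_def)
qed

lemma bdiag_cong:
  assumes "\<And>i. i \<in> {1..m} \<Longrightarrow> B i = C i"
  shows "bdiag m B = bdiag m C"
  unfolding bdiag_def by (rule arg_cong[where f = diag_block_mat]) (use assms in auto)

lemma bdiag_carrier:
  assumes "\<And>i. i \<in> {1..m} \<Longrightarrow> B i \<in> carrier_mat (d i) (d i)"
  shows "bdiag m B \<in> carrier_mat (offset d (Suc m)) (offset d (Suc m))"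
  using assms
proof (induction m)
  case 0 then show ?case by (simp add: bdiag_0 offset_def)
next
  case (Suc m)
  then have "bdiag m B \<in> carrier_mat (offset d (Suc m)) (offset d (Suc m))"
    and "B (Suc m) \<in> carrier_mat (d (Suc m)) (d (Suc m))" by auto
  then show ?case unfolding bdiag_Suc offset_Suc by simp
qed

lemma bdiag_index:
  assumes "\<And>i. i \<in> {1..m} \<Longrightarrow> B i \<in> carrier_mat (d i) (d i)"
    and "i \<in> {1..m}" "y < d i" "i' \<in> {1..m}" "y' < d i'"
  shows "bdiag m B $$ (offset d i + y, offset d i' + y') = (if i = i' then B i $$ (y, y') else 0)"
  using assms
proof (induction m)
  case 0 then show ?case by simp
next
  case (Suc m)
  have c: "bdiag m B \<in> carrier_mat (offset d (Suc m)) (offset d (Suc m))"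
    using Suc.prems by (intro bdiag_carrier) auto
  have cB: "B (Suc m) \<in> carrier_mat (d (Suc m)) (d (Suc m))"
    using Suc.prems by auto
  have less: "offset d j + z < offset d (Suc m)" if "j \<in> {1..Suc m}" "j \<noteq> Suc m" "z < d j" for j z
    using that by (intro offset_less) auto
  have blk: "bdiag (Suc m) B $$ (u, v) =
      (if u < offset d (Suc m)
       then if v < offset d (Suc m) then bdiag m B $$ (u, v) else 0
       else if v < offset d (Suc m) then 0
       else B (Suc m) $$ (u - offset d (Suc m), v - offset d (Suc m)))"
    if "u < offset d (Suc m) + d (Suc m)" "v < offset d (Suc m) + d (Suc m)" for u v
  proof -
    have dims: "dim_row (bdiag m B) = offset d (Suc m)" "dim_col (bdiag m B) = offset d (Suc m)"
      "dim_row (B (Suc m)) = d (Suc m)" "dim_col (B (Suc m)) = d (Suc m)"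
      using c cB by simp_all
    show ?thesis
      unfolding bdiag_Suc using that by (simp add: dims)
  qed
  have u: "offset d i + y < offset d (Suc m) + d (Suc m)"
    and v: "offset d i' + y' < offset d (Suc m) + d (Suc m)"
    using offset_less[of i "Suc m" y d] offset_less[of i' "Suc m" y' d] Suc.prems(2-5)
    by (simp_all add: offset_Suc)
  show ?case
  proof (cases "i = Suc m \<or> i' = Suc m")
    case True
    then show ?thesis
      unfolding blk[OF u v] using Suc.prems(2-5) less[of i y] less[of i' y'] by auto
  next
    case False
    then have "i \<in> {1..m}" "i' \<in> {1..m}" using Suc.prems(2,4) by auto
    moreover have "B j \<in> carrier_mat (d j) (d j)" if "j \<in> {1..m}" for j
      using that Suc.prems(1) by simp
    ultimately show ?thesis
      unfolding blk[OF u v] using Suc.IH Suc.prems(2-5) less[of i y] less[of i' y'] False by simp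
  qed
qed

lemma bdiag_mult:
  assumes "\<And>i. i \<in> {1..m} \<Longrightarrow> B i \<in> carrier_mat (d i) (d i)"
    and "\<And>i. i \<in> {1..m} \<Longrightarrow> C i \<in> carrier_mat (d i) (d i)"
  shows "bdiag m B * bdiag m C = bdiag m (\<lambda>i. B i * C i)"
  using assms
proof (induction m)
  case 0 then show ?case by (auto simp: bdiag_0)
next
  case (Suc m)
  define n where "n = offset d (Suc m)"
  have c: "bdiag m B \<in> carrier_mat n n" "bdiag m C \<in> carrier_mat n n"
    unfolding n_def using Suc.prems by (auto intro!: bdiag_carrier)
  have c': "bdiag m (\<lambda>i. B i * C i) \<in> carrier_mat n n"
    unfolding n_def
  proof (rule bdiag_carrier)
    fix i assume "i \<in> {1..m}"
    then have "i \<in> {1..Suc m}" by simp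
    then show "B i * C i \<in> carrier_mat (d i) (d i)"
      using Suc.prems mult_carrier_mat by blast
  qed
  have b: "B (Suc m) \<in> carrier_mat (d (Suc m)) (d (Suc m))"
    "C (Suc m) \<in> carrier_mat (d (Suc m)) (d (Suc m))"
    using Suc.prems by auto
  have IH: "bdiag m B * bdiag m C = bdiag m (\<lambda>i. B i * C i)" using Suc by simp
  have dims: "dim_row (bdiag m B) = n" "dim_col (bdiag m B) = n"
    "dim_row (bdiag m C) = n" "dim_col (bdiag m C) = n"
    "dim_row (bdiag m (\<lambda>i. B i * C i)) = n" "dim_col (bdiag m (\<lambda>i. B i * C i)) = n"
    "dim_row (B (Suc m)) = d (Suc m)" "dim_col (B (Suc m)) = d (Suc m)"
    "dim_row (C (Suc m)) = d (Suc m)" "dim_col (C (Suc m)) = d (Suc m)"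
    using c c' b by auto
  show ?case
    unfolding bdiag_Suc index_mult_mat dims
    by (subst mult_four_block_mat[OF c(1) _ _ b(1) c(2) _ _ b(2)])
       (use c b c' IH in auto)
qed

lemma bdiag_transpose:
  assumes "\<And>i. i \<in> {1..m} \<Longrightarrow> B i \<in> carrier_mat (d i) (d i)"
  shows "transpose_mat (bdiag m B) = bdiag m (\<lambda>i. transpose_mat (B i))"
  using assms
proof (induction m)
  case 0 then show ?case by (auto simp: bdiag_0)
next
  case (Suc m)
  define n where "n = offset d (Suc m)"
  have c: "bdiag m B \<in> carrier_mat n n"
    unfolding n_def using Suc.prems by (auto intro!: bdiag_carrier)
  have c': "bdiag m (\<lambda>i. transpose_mat (B i)) \<in> carrier_mat n n"
    unfolding n_def using Suc.prems by (auto intro!: bdiag_carrier)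
  have b: "B (Suc m) \<in> carrier_mat (d (Suc m)) (d (Suc m))" using Suc.prems by auto
  have IH: "transpose_mat (bdiag m B) = bdiag m (\<lambda>i. transpose_mat (B i))" using Suc by simp
  show ?case
    unfolding bdiag_Suc
    by (subst transpose_four_block_mat[OF c _ _ b])
       (use c c' b IH in auto)
qed

lemma bdiag_inject:
  assumes B: "\<And>i. i \<in> {1..m} \<Longrightarrow> B i \<in> carrier_mat (d i) (d i)"
    and C: "\<And>i. i \<in> {1..m} \<Longrightarrow> C i \<in> carrier_mat (d i) (d i)"
    and eq: "bdiag m B = bdiag m C" and i: "i \<in> {1..m}"
  shows "B i = C i"
proof (rule eq_matI)
  fix y y' assume "y < dim_row (C i)" "y' < dim_col (C i)"
  then have y: "y < d i" "y' < d i" using C[OF i] by auto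
  show "B i $$ (y, y') = C i $$ (y, y')"
    using bdiag_index[of m B d, OF B i y(1) i y(2)] bdiag_index[of m C d, OF C i y(1) i y(2)] eq
    by simp
qed (use B[OF i] C[OF i] in auto)

lemma bdiag_eqI:
  assumes X: "X \<in> carrier_mat (offset d (Suc m)) (offset d (Suc m))"
    and B: "\<And>i. i \<in> {1..m} \<Longrightarrow> B i \<in> carrier_mat (d i) (d i)"
    and eq: "\<And>i y i' y'. i \<in> {1..m} \<Longrightarrow> y < d i \<Longrightarrow> i' \<in> {1..m} \<Longrightarrow> y' < d i' \<Longrightarrow>
      X $$ (offset d i + y, offset d i' + y') = (if i = i' then B i $$ (y, y') else 0)"
  shows "X = bdiag m B"
proof (rule eq_matI)
  have c: "bdiag m B \<in> carrier_mat (offset d (Suc m)) (offset d (Suc m))"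
    using B by (rule bdiag_carrier)
  show "dim_row X = dim_row (bdiag m B)" "dim_col X = dim_col (bdiag m B)" using X c by auto
  fix u v assume "u < dim_row (bdiag m B)" "v < dim_col (bdiag m B)"
  then have "u < offset d (Suc m)" "v < offset d (Suc m)" using c by auto
  then obtain i y i' y' where "i \<in> {1..m}" "y < d i" "u = offset d i + y"
    "i' \<in> {1..m}" "y' < d i'" "v = offset d i' + y'"
    by (metis offset_cover)
  then show "X $$ (u, v) = bdiag m B $$ (u, v)"
    using eq bdiag_index[of m B d, OF B] by simp
qed

lemma bdiag_one:
  "bdiag m (\<lambda>i. 1\<^sub>m (d i)) = 1\<^sub>m (offset d (Suc m))"
proof (induction m)
  case 0 then show ?case by (auto simp: bdiag_0 offset_def)
next
  case (Suc m)
  show ?case unfolding bdiag_Suc Suc offset_Suc by auto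
qed

section \<open>The projection onto cell-constant vectors\<close>

lemma diag_unif_carrier:
  "diag_block_mat (replicate s (unif_mat k)) \<in> carrier_mat (s * k) (s * k)"
proof (induction s)
  case 0 then show ?case by simp
next
  case (Suc s)
  have "unif_mat k \<in> carrier_mat k k" by (simp add: unif_mat_def)
  with Suc show ?case by (simp add: Let_def)
qed

text \<open>
  Inside a block the indices fall into cells of \<open>k\<close> consecutive ones, and
  \<open>i div k\<close> is the number of the cell of \<open>i\<close>.
\<close>

lemma diag_unif_index:
  assumes "0 < k" "i < s * k" "j < s * k"
  shows "diag_block_mat (replicate s (unif_mat k)) $$ (i, j)
    = (if i div k = j div k then 1 / real k else 0)"
  using assms
proof (induction s arbitrary: i j)
  case 0 then show ?case by simp
next
  case (Suc s)
  let ?D = "diag_block_mat (replicate s (unif_mat k))"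
  have D: "dim_row ?D = s * k" "dim_col ?D = s * k"
    using diag_unif_carrier[of s k] by auto
  have U: "dim_row (unif_mat k) = k" "dim_col (unif_mat k) = k"
    by (auto simp: unif_mat_def)
  have shift: "x div k = Suc ((x - k) div k)" if "\<not> x < k" for x
    using that \<open>0 < k\<close> by (simp add: le_div_geq)
  have shift': "x - k < s * k" if "\<not> x < k" "x < Suc s * k" for x
    using that by auto
  have "diag_block_mat (replicate (Suc s) (unif_mat k)) $$ (i, j) =
      (if i < k then if j < k then 1 / real k else 0
       else if j < k then 0 else ?D $$ (i - k, j - k))"
    using Suc.prems by (auto simp: Let_def D U) (auto simp: unif_mat_def)
  then show ?case
    using Suc.IH[of "i - k" "j - k"] Suc.prems shift[of i] shift[of j] shift'[of i] shift'[of j]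
    by auto
qed

lemma diag_unif_transpose:
  "transpose_mat (diag_block_mat (replicate s (unif_mat k))) = diag_block_mat (replicate s (unif_mat k))"
proof (cases "k = 0")
  case True
  then show ?thesis using diag_unif_carrier[of s k] by (intro eq_matI) auto
next
  case False
  then show ?thesis
    using diag_unif_carrier[of s k] by (intro eq_matI) (auto simp: diag_unif_index)
qed

lemma restr_range_space_eq_iff:
  fixes M N Z :: "real mat"
  assumes M: "M \<in> carrier_mat d d" and N: "N \<in> carrier_mat d d" and Z: "Z \<in> carrier_mat d d"
  shows "restr M (range_space Z) = restr N (range_space Z) \<longleftrightarrow> M * Z = N * Z"
proof -
  have range: "range_space Z = (\<lambda>v. Z *\<^sub>v v) ` carrier_vec d"
    using range_space_eq[of Z] Z by simp
  show ?thesis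
  proof
    assume eq: "M * Z = N * Z"
    show "restr M (range_space Z) = restr N (range_space Z)"
      unfolding restr_def
    proof (rule restrict_ext)
      fix v assume "v \<in> range_space Z"
      then obtain w where w: "w \<in> carrier_vec d" "v = Z *\<^sub>v w" using range by auto
      show "M *\<^sub>v v = N *\<^sub>v v"
        using assoc_mult_mat_vec[OF M Z w(1)] assoc_mult_mat_vec[OF N Z w(1)] eq w(2) by simp
    qed
  next
    assume eq: "restr M (range_space Z) = restr N (range_space Z)"
    show "M * Z = N * Z"
    proof (rule mat_eq_by_vecs[of _ d])
      fix v :: "real vec" assume v: "v \<in> carrier_vec d"
      then have "Z *\<^sub>v v \<in> range_space Z" using range by auto
      then have "M *\<^sub>v (Z *\<^sub>v v) = N *\<^sub>v (Z *\<^sub>v v)"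
        using fun_cong[OF eq, of "Z *\<^sub>v v"] by (simp add: restr_def)
      then show "M * Z *\<^sub>v v = N * Z *\<^sub>v v"
        using assoc_mult_mat_vec[OF M Z v] assoc_mult_mat_vec[OF N Z v] by simp
    qed (use M N Z in auto)
  qed
qed

section \<open>Nonnegative isometries permute cells\<close>

text \<open>
  For a nonnegative matrix no cancellation can occur in the inner product of two columns.
\<close>

lemma gram_entry_nonzero:
  fixes X :: "real mat"
  assumes X: "X \<in> carrier_mat n n"
    and nonneg: "\<And>i j. i < n \<Longrightarrow> j < n \<Longrightarrow> 0 \<le> X $$ (i, j)"
    and less: "i < n" "j < n" "l < n" and nz: "X $$ (i, j) \<noteq> 0" "X $$ (i, l) \<noteq> 0"
  shows "(transpose_mat X * X) $$ (j, l) \<noteq> 0"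
proof -
  have "0 < X $$ (i, j) * X $$ (i, l)"
    using nonneg[of i j] nonneg[of i l] less nz by (simp add: less_le)
  also have "\<dots> \<le> (\<Sum>a<n. X $$ (a, j) * X $$ (a, l))"
    using less nonneg by (intro member_le_sum[where f = "\<lambda>a. X $$ (a, j) * X $$ (a, l)"]) auto
  also have "\<dots> = (transpose_mat X * X) $$ (j, l)"
    using X less by (simp add: scalar_prod_def atLeast0LessThan)
  finally show ?thesis by simp
qed

text \<open>
  Indices at which \<open>Z\<close> has a nonzero entry are to be thought of as members of one cell; by
  \<open>cells\<close> the rows of \<open>Z\<close> are constant on cells.
  Two nonzero entries in a row of \<open>X\<close> lie in columns whose inner product, an entry of
  \<open>Z = X\<^sup>T X\<close>, is nonzero; so they lie in the same cell, and \<open>X = X Z\<close>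
  forces them to be equal. All nonzero entries of the row thus have one common value. The row sums to 1,
  so this value is also the sum of the squares of the row, which is the diagonal entry of
  \<open>X X\<^sup>T = Z\<close>.
\<close>

lemma isometry_row_entry:
  fixes X Z :: "real mat"
  assumes X: "X \<in> carrier_mat n n" and Z: "Z \<in> carrier_mat n n"
    and nonneg: "\<And>i j. i < n \<Longrightarrow> j < n \<Longrightarrow> 0 \<le> X $$ (i, j)"
    and row: "\<And>i. i < n \<Longrightarrow> (\<Sum>j<n. X $$ (i, j)) = 1"
    and XZ: "X * Z = X" and XTX: "transpose_mat X * X = Z" and XXT: "X * transpose_mat X = Z"
    and cells: "\<And>i j l. i < n \<Longrightarrow> j < n \<Longrightarrow> l < n \<Longrightarrow> Z $$ (i, j) \<noteq> 0 \<Longrightarrow> Z $$ (l, i) = Z $$ (l, j)"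
    and ij: "i < n" "j < n" "X $$ (i, j) \<noteq> 0"
  shows "X $$ (i, j) = Z $$ (i, i)"
proof -
  have const: "X $$ (i, l) = X $$ (i, j)" if l: "l < n" "X $$ (i, l) \<noteq> 0" for l
  proof -
    have "Z $$ (j, l) \<noteq> 0"
      using gram_entry_nonzero[OF X nonneg ij(1,2) l(1) ij(3) l(2)] XTX by simp
    then have same: "Z $$ (a, j) = Z $$ (a, l)" if "a < n" for a
      using cells ij l that by blast
    have "(X * Z) $$ (i, l) = (X * Z) $$ (i, j)"
      using X Z ij l same by (simp add: scalar_prod_def)
    then show ?thesis unfolding XZ .
  qed
  have "Z $$ (i, i) = (\<Sum>l<n. X $$ (i, l) * X $$ (i, l))"
    using X ij unfolding XXT[symmetric] by (simp add: scalar_prod_def atLeast0LessThan)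
  also have "\<dots> = (\<Sum>l<n. X $$ (i, j) * X $$ (i, l))"
    by (rule sum.cong) (use const in auto)
  also have "\<dots> = X $$ (i, j)" using row[OF ij(1)] by (simp flip: sum_distrib_left)
  finally show ?thesis by simp
qed

text \<open>
  The transpose of \<open>X\<close> satisfies the hypotheses on \<open>X\<close>, so a nonzero entry is
  determined by its column as well as by its row. For the projection onto cell-constant vectors the
  diagonal of \<open>Z\<close> records the reciprocals of the cell sizes, and so \<open>X\<close> can only
  connect cells of equal size.
\<close>

lemma isometry_entry:
  fixes X Z :: "real mat"
  assumes X: "doubly_stochastic n X" and Z: "Z \<in> carrier_mat n n" "transpose_mat Z = Z"
    and iso: "X * Z = X" "Z * X = X" "transpose_mat X * X = Z" "X * transpose_mat X = Z"
    and cells: "\<And>i j l. i < n \<Longrightarrow> j < n \<Longrightarrow> l < n \<Longrightarrow> Z $$ (i, j) \<noteq> 0 \<Longrightarrow> Z $$ (l, i) = Z $$ (l, j)"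
    and ij: "i < n" "j < n" "X $$ (i, j) \<noteq> 0"
  shows "X $$ (i, j) = Z $$ (i, i)" "X $$ (i, j) = Z $$ (j, j)"
proof -
  have Xc: "X \<in> carrier_mat n n" and nn: "\<And>i j. i < n \<Longrightarrow> j < n \<Longrightarrow> 0 \<le> X $$ (i, j)"
    and row: "\<And>i. i < n \<Longrightarrow> (\<Sum>j<n. X $$ (i, j)) = 1"
    and col: "\<And>j. j < n \<Longrightarrow> (\<Sum>i<n. X $$ (i, j)) = 1"
    using X by (auto simp: doubly_stochastic_def)
  show "X $$ (i, j) = Z $$ (i, i)"
    by (rule isometry_row_entry[OF Xc Z(1) nn row iso(1,3,4) cells ij])
  have tX: "transpose_mat X \<in> carrier_mat n n" using Xc by simp
  have "transpose_mat X * Z = transpose_mat X"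
    using transpose_mult[OF Z(1) Xc] iso(2) Z(2) by simp
  then have "transpose_mat X $$ (j, i) = Z $$ (j, j)"
    using Xc ij nn col iso by (intro isometry_row_entry[OF tX Z(1) _ _ _ _ _ cells]) auto
  then show "X $$ (i, j) = Z $$ (j, j)" using Xc ij by simp
qed

text \<open>
  Because \<open>X = X Z = Z X\<close>, the matrix \<open>X\<close> is constant on products of cells, and
  since rows from different cells are orthogonal, and so are columns, its nonzero products of
  cells form the graph of an injection \<open>\<tau>\<close> of the \<open>s\<close> cells into themselves. The
  permutation of the indices that moves cell \<open>t\<close> to cell \<open>\<tau> t\<close> and keeps the order
  inside the cells is the required \<open>Q\<close>.
\<close>

lemma cell_constant_eq_unif_perm:
  fixes X :: "real mat"
  assumes k: "0 < k" and Z_def: "Z = diag_block_mat (replicate s (unif_mat k))"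
    and X: "X \<in> carrier_mat (s * k) (s * k)"
    and nonneg: "\<And>i j. i < s * k \<Longrightarrow> j < s * k \<Longrightarrow> 0 \<le> X $$ (i, j)"
    and entry: "\<And>i j. i < s * k \<Longrightarrow> j < s * k \<Longrightarrow> X $$ (i, j) \<noteq> 0 \<Longrightarrow> X $$ (i, j) = 1 / real k"
    and XZ: "X * Z = X" and ZX: "Z * X = X"
    and XTX: "transpose_mat X * X = Z" and XXT: "X * transpose_mat X = Z"
  shows "\<exists>Q. permutation_mat (s * k) Q \<and> X = Z * Q \<and> Q * Z = Z * Q"
proof -
  define d where "d = s * k"
  note Xc = X[folded d_def] and nn = nonneg[folded d_def] and entry = entry[folded d_def]
  have Zc: "Z \<in> carrier_mat d d" unfolding Z_def d_def by (rule diag_unif_carrier)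
  have Z: "Z $$ (i, j) = (if i div k = j div k then 1 / real k else 0)" if "i < d" "j < d" for i j
    using that diag_unif_index[OF k] unfolding Z_def d_def by simp
  have div: "i div k < s" if "i < d" for i
    using that k unfolding d_def by (simp add: less_mult_imp_div_less)
  have mult: "t * k < d" if "t < s" for t
    using that k unfolding d_def by simp
  have XZ_entry: "X $$ (i, j) = (\<Sum>l<d. X $$ (i, l) * Z $$ (l, j))" if "i < d" "j < d" for i j
    using Xc Zc that by (subst XZ[symmetric]) (simp add: scalar_prod_def atLeast0LessThan)
  have ZX_entry: "X $$ (i, j) = (\<Sum>l<d. Z $$ (i, l) * X $$ (l, j))" if "i < d" "j < d" for i j
    using Xc Zc that by (subst ZX[symmetric]) (simp add: scalar_prod_def atLeast0LessThan)
  have const_col: "X $$ (i, j) = X $$ (i, j')" if "i < d" "j < d" "j' < d" "j div k = j' div k" for i j j'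
    unfolding XZ_entry[OF that(1,2)] XZ_entry[OF that(1,3)] using that by (intro sum.cong) (auto simp: Z)
  have const_row: "X $$ (i, j) = X $$ (i', j)" if "i < d" "i' < d" "j < d" "i div k = i' div k" for i i' j
    unfolding ZX_entry[OF that(1,3)] ZX_entry[OF that(2,3)] using that by (intro sum.cong) (auto simp: Z)
  have row_unique: "j div k = l div k"
    if "i < d" "j < d" "l < d" "X $$ (i, j) \<noteq> 0" "X $$ (i, l) \<noteq> 0" for i j l
    using gram_entry_nonzero[OF Xc nn that] Z[OF that(2,3)] XTX by (auto split: if_splits)
  have tXc: "transpose_mat X \<in> carrier_mat d d" using Xc by simp
  have col_unique: "i div k = l div k"
    if "i < d" "j < d" "l < d" "X $$ (i, j) \<noteq> 0" "X $$ (l, j) \<noteq> 0" for i j l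
  proof -
    have "(transpose_mat (transpose_mat X) * transpose_mat X) $$ (i, l) \<noteq> 0"
      by (rule gram_entry_nonzero[OF tXc _ that(2,1,3)]) (use that Xc nn in auto)
    then show ?thesis using Z[OF that(1,3)] XXT by (auto split: if_splits)
  qed
  have row_exists: "\<exists>j<d. X $$ (i, j) \<noteq> 0" if "i < d" for i
  proof (rule ccontr)
    assume "\<not> ?thesis"
    then have "(\<Sum>a<d. X $$ (i, a) * X $$ (i, a)) = 0" by (intro sum.neutral) auto
    moreover have "(\<Sum>a<d. X $$ (i, a) * X $$ (i, a)) = Z $$ (i, i)"
      using Xc that unfolding XXT[symmetric] by (simp add: scalar_prod_def atLeast0LessThan)
    ultimately show False using Z[OF that that] k by simp
  qed
  have "\<exists>u. \<forall>j<d. X $$ (t * k, j) \<noteq> 0 \<longrightarrow> j div k = u" if t: "t < s" for t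
    using row_unique[OF mult[OF t]] by metis
  then obtain \<tau> where \<tau>: "\<And>t j. t < s \<Longrightarrow> j < d \<Longrightarrow> X $$ (t * k, j) \<noteq> 0 \<Longrightarrow> j div k = \<tau> t"
    by metis
  have X_iff: "X $$ (i, j) \<noteq> 0 \<longleftrightarrow> j div k = \<tau> (i div k)" if i: "i < d" and j: "j < d" for i j
  proof -
    have base: "X $$ (i, l) = X $$ (i div k * k, l)" if "l < d" for l
      using const_row[OF i mult[OF div[OF i]] that] k by simp
    obtain l where l: "l < d" "X $$ (i, l) \<noteq> 0" using row_exists[OF i] by auto
    have "l div k = \<tau> (i div k)" using \<tau>[OF div[OF i] l(1)] base[OF l(1)] l(2) by simp
    then show ?thesis
      using \<tau>[OF div[OF i] j] base[OF j] const_col[OF i j l(1)] l(2) by auto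
  qed
  have X_eq: "X $$ (i, j) = (if j div k = \<tau> (i div k) then 1 / real k else 0)"
    if "i < d" "j < d" for i j
    using X_iff[OF that] entry[OF that] by auto
  have \<tau>_less: "\<tau> t < s" if t: "t < s" for t
  proof -
    obtain j where "j < d" "X $$ (t * k, j) \<noteq> 0" using row_exists[OF mult[OF t]] by auto
    then show ?thesis using \<tau>[OF t] div by metis
  qed
  have \<tau>_inj: "t = u" if t: "t < s" and u: "u < s" and eq: "\<tau> t = \<tau> u" for t u
  proof -
    have "X $$ (t * k, \<tau> t * k) \<noteq> 0" "X $$ (u * k, \<tau> t * k) \<noteq> 0"
      using X_iff[OF mult[OF t] mult[OF \<tau>_less[OF t]]] X_iff[OF mult[OF u] mult[OF \<tau>_less[OF t]]]
        eq k by simp_all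
    then have "t * k div k = u * k div k"
      using col_unique[OF mult[OF t] mult[OF \<tau>_less[OF t]] mult[OF u]] by blast
    then show ?thesis using k by simp
  qed
  define q where "q i = (if i < d then \<tau> (i div k) * k + i mod k else i)" for i
  have q_div: "q i div k = \<tau> (i div k)" and q_mod: "q i mod k = i mod k" if "i < d" for i
    using that k unfolding q_def by simp_all
  have q_less: "q i < d" if "i < d" for i
  proof -
    have "\<tau> (i div k) * k + i mod k < Suc (\<tau> (i div k)) * k" using k by simp
    also have "\<dots> \<le> s * k" using \<tau>_less[OF div[OF that]] by (intro mult_right_mono) auto
    finally show ?thesis using that unfolding q_def d_def by simp
  qed
  have q_inj: "inj_on q {..<d}"
  proof (rule inj_onI)
    fix i j assume "i \<in> {..<d}" "j \<in> {..<d}" and eq: "q i = q j"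
    then have "i < d" "j < d" by auto
    then have "i div k = j div k" "i mod k = j mod k"
      using q_div q_mod \<tau>_inj[OF div div] eq by metis+
    then show "i = j" by (metis div_mult_mod_eq)
  qed
  have q_image: "q ` {..<d} = {..<d}"
    by (rule endo_inj_surj[OF _ _ q_inj]) (use q_less in auto)
  have q_perm: "q permutes {..<d}"
    by (rule bij_imp_permutes) (use q_inj q_image in \<open>auto simp: bij_betw_def q_def\<close>)
  define Q where "Q = mat d d (\<lambda>(i, j). if j = q i then 1 else (0::real))"
  have Qc: "Q \<in> carrier_mat d d" unfolding Q_def by simp
  have QZ: "Q * Z = X"
  proof (rule eq_matI)
    fix i j assume "i < dim_row X" "j < dim_col X"
    then have i: "i < d" and j: "j < d" using Xc by auto
    have "(Q * Z) $$ (i, j) = (\<Sum>l<d. (if l = q i then 1 else 0) * Z $$ (l, j))"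
      using Qc Zc i j by (simp add: Q_def scalar_prod_def atLeast0LessThan)
    also have "\<dots> = Z $$ (q i, j)"
      using q_less[OF i] by (simp add: if_distrib[of "\<lambda>x. x * _"] cong: if_cong)
    also have "\<dots> = X $$ (i, j)"
      using Z[OF q_less[OF i] j] X_eq[OF i j] q_div[OF i] by auto
    finally show "(Q * Z) $$ (i, j) = X $$ (i, j)" .
  qed (use Qc Zc Xc in auto)
  have ZQ: "Z * Q = X"
  proof (rule eq_matI)
    fix i j assume "i < dim_row X" "j < dim_col X"
    then have i: "i < d" and j: "j < d" using Xc by auto
    obtain h where h: "h < d" "j = q h" using q_image j by (metis imageE lessThan_iff)
    have "(Z * Q) $$ (i, j) = (\<Sum>l<d. Z $$ (i, l) * (if j = q l then 1 else 0))"
      using Qc Zc i j by (simp add: Q_def scalar_prod_def atLeast0LessThan)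
    also have "\<dots> = (\<Sum>l<d. if l = h then Z $$ (i, l) else 0)"
      using q_inj h by (intro sum.cong) (auto dest: inj_onD)
    also have "\<dots> = Z $$ (i, h)" using h by simp
    also have "\<dots> = X $$ (i, j)"
      using Z[OF i h(1)] X_eq[OF i j] q_div[OF h(1)] h(2) \<tau>_inj[OF div[OF i] div[OF h(1)]] by auto
    finally show "(Z * Q) $$ (i, j) = X $$ (i, j)" .
  qed (use Qc Zc Xc in auto)
  have "permutation_mat d Q" unfolding permutation_mat_def Q_def using q_perm by blast
  then show ?thesis using QZ ZQ unfolding d_def by metis
qed

section \<open>Braid relations block by block\<close>

text \<open>
  As \<open>Z\<close> is idempotent and commutes with \<open>A\<close> and \<open>Q\<close>, all its occurrences
  can be collected in one factor on the right, which restricts both sides to the range of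
  \<open>Z\<close>.
\<close>

lemma braid_blocks_iff:
  fixes A Z Q :: "real mat"
  assumes A: "A \<in> carrier_mat d d" and Z: "Z \<in> carrier_mat d d" and Q: "Q \<in> carrier_mat d d"
    and idem: "Z * Z = Z" and AZ: "A * Z = Z * A" and QZ: "Q * Z = Z * Q"
  shows "A * (Z * Q) * A = Z * Q * A * (Z * Q)
    \<longleftrightarrow> restr (A * Q * A) (range_space Z) = restr (Q * A * Q) (range_space Z)"
proof -
  note mults = mult_carrier_mat[of _ d d _ d]
  note norm = assoc_mult_mat[of _ d d _ d _ d] mults A Z Q
  have pull: "B * C * Z = Z * (B * C)" if BZ: "B * Z = Z * B" and CZ: "C * Z = Z * C"
    and B: "B \<in> carrier_mat d d" and C: "C \<in> carrier_mat d d" for B C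
  proof -
    have "B * C * Z = B * Z * C" using CZ by (simp add: norm B C)
    also have "\<dots> = Z * (B * C)" unfolding BZ by (simp add: norm B C)
    finally show ?thesis .
  qed
  have "A * (Z * Q) * A = A * Z * (Q * A)" by (simp add: norm)
  also have "\<dots> = Z * (A * Q * A)" unfolding AZ by (simp add: norm)
  also have "\<dots> = A * Q * A * Z"
    by (rule pull[OF pull[OF AZ QZ A Q] AZ mults[OF A Q] A, symmetric])
  finally have l: "A * (Z * Q) * A = A * Q * A * Z" .
  have "Z * Q * A * (Z * Q) = Z * (Q * A * Z) * Q" by (simp add: norm)
  also have "\<dots> = Z * Z * (Q * A * Q)" unfolding pull[OF QZ AZ Q A] by (simp add: norm)
  also have "\<dots> = Q * A * Q * Z"
    unfolding idem by (rule pull[OF pull[OF QZ AZ Q A] QZ mults[OF Q A] Q, symmetric])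
  finally have r: "Z * Q * A * (Z * Q) = Q * A * Q * Z" .
  show ?thesis
    unfolding l r
    using restr_range_space_eq_iff[OF mults[OF mults[OF A Q] A] mults[OF mults[OF Q A] Q] Z]
    by simp
qed

theorem theorem4p4:
  fixes n m :: nat
    and d k s :: "nat \<Rightarrow> nat"
    and Z A X :: "real mat"
    and Zb Ab :: "nat \<Rightarrow> real mat"
  assumes k_pos: "\<forall>i\<in>{1..m}. 0 < k i"
    and s_pos: "\<forall>i\<in>{1..m}. 0 < s i"
    and d_eq: "\<forall>i\<in>{1..m}. d i = s i * k i"
    and k_distinct: "inj_on k {1..m}"
    and Zb_eq: "\<forall>i\<in>{1..m}. Zb i = diag_block_mat (replicate (s i) (unif_mat (k i)))"
    and Z_eq: "Z = bdiag m Zb"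
    and Z_ds: "doubly_stochastic n Z"
    and Z_proj: "projection_mat n Z"
    and Ab_dim: "\<forall>i\<in>{1..m}. Ab i \<in> carrier_mat (d i) (d i)"
    and A_eq: "A = bdiag m Ab"
    and A_perm: "permutation_mat n A"
    and A_comm: "A * Z = Z * A"
    and X_ds: "doubly_stochastic n X"
  shows "(A * X * A = X * A * X \<and> mat_kernel X = mat_kernel Z)
    \<longleftrightarrow>
    (\<exists>Q. (\<forall>i\<in>{1..m}. permutation_mat (d i) (Q i))
       \<and> X = bdiag m (\<lambda>i. Zb i * Q i)
       \<and> (\<forall>i\<in>{1..m}. Q i * Zb i = Zb i * Q i
            \<and> restr (Ab i * Q i * Ab i) (range_space (Zb i))
              = restr (Q i * Ab i * Q i) (range_space (Zb i))))"
proof -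
  define I where "I = {1..m}"
  have Zb: "Zb i \<in> carrier_mat (d i) (d i)" if "i \<in> I" for i
    using that Zb_eq d_eq diag_unif_carrier unfolding I_def by simp
  have Ab: "Ab i \<in> carrier_mat (d i) (d i)" if "i \<in> I" for i
    using that Ab_dim unfolding I_def by blast
  have mults: "B * C \<in> carrier_mat (d i) (d i)"
    if "B \<in> carrier_mat (d i) (d i)" "C \<in> carrier_mat (d i) (d i)" for B C :: "real mat" and i
    using that by (rule mult_carrier_mat)
  note bmult = bdiag_mult[of m _ d, folded I_def]
  note binj = bdiag_inject[of m _ d, folded I_def]
  note bcong = bdiag_cong[of m, folded I_def]
  have Zc: "Z \<in> carrier_mat n n" and Xc: "X \<in> carrier_mat n n"
    using Z_ds X_ds by (auto simp: doubly_stochastic_def)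
  have Z_off: "Z \<in> carrier_mat (offset d (Suc m)) (offset d (Suc m))"
    unfolding Z_eq by (rule bdiag_carrier) (use Zb I_def in auto)
  have n: "n = offset d (Suc m)" using Zc Z_off by (metis carrier_matD(1))
  have Ac: "A \<in> carrier_mat n n"
    unfolding A_eq n by (rule bdiag_carrier) (use Ab I_def in auto)
  have idem: "Z * Z = Z" using Z_proj by (simp add: projection_mat_def)
  have Zb_idem: "Zb i * Zb i = Zb i" if "i \<in> I" for i
    by (rule binj[OF mults[OF Zb Zb] Zb _ that])
       (use idem in \<open>simp_all add: Z_eq bmult[OF Zb Zb]\<close>)
  have Ab_comm: "Ab i * Zb i = Zb i * Ab i" if "i \<in> I" for i
    by (rule binj[OF mults[OF Ab Zb] mults[OF Zb Ab] _ that])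
       (use A_comm in \<open>simp_all add: Z_eq A_eq bmult[OF Ab Zb] bmult[OF Zb Ab]\<close>)
  have braid_bdiag_iff: "A * bdiag m B * A = bdiag m B * A * bdiag m B
      \<longleftrightarrow> (\<forall>i\<in>I. Ab i * B i * Ab i = B i * Ab i * B i)"
    if B: "\<And>i. i \<in> I \<Longrightarrow> B i \<in> carrier_mat (d i) (d i)" for B
  proof -
    have l: "A * bdiag m B * A = bdiag m (\<lambda>i. Ab i * B i * Ab i)"
      unfolding A_eq
      by (subst bmult, simp add: Ab B, simp add: Ab B, rule bmult) (simp_all add: Ab B mults)
    have r: "bdiag m B * A * bdiag m B = bdiag m (\<lambda>i. B i * Ab i * B i)"
      unfolding A_eq
      by (subst bmult, simp add: Ab B, simp add: Ab B, rule bmult) (simp_all add: Ab B mults)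
    show ?thesis
      unfolding l r
    proof
      assume eq: "bdiag m (\<lambda>i. Ab i * B i * Ab i) = bdiag m (\<lambda>i. B i * Ab i * B i)"
      show "\<forall>i\<in>I. Ab i * B i * Ab i = B i * Ab i * B i"
      proof
        fix i assume "i \<in> I"
        then show "Ab i * B i * Ab i = B i * Ab i * B i"
          using binj[of "\<lambda>i. Ab i * B i * Ab i" "\<lambda>i. B i * Ab i * B i" i] eq
          by (simp add: Ab B mults)
      qed
    next
      assume "\<forall>i\<in>I. Ab i * B i * Ab i = B i * Ab i * B i"
      then show "bdiag m (\<lambda>i. Ab i * B i * Ab i) = bdiag m (\<lambda>i. B i * Ab i * B i)"
        by (intro bcong) blast
    qed
  qed
  have perm_carrier: "Q \<in> carrier_mat r r" if "permutation_mat r Q" for Q r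
    using that by (auto simp: permutation_mat_def)
  show ?thesis
    unfolding I_def[symmetric]
  proof
    assume lhs: "A * X * A = X * A * X \<and> mat_kernel X = mat_kernel Z"
    show "\<exists>Q. (\<forall>i\<in>I. permutation_mat (d i) (Q i)) \<and> X = bdiag m (\<lambda>i. Zb i * Q i)
       \<and> (\<forall>i\<in>I. Q i * Zb i = Zb i * Q i
            \<and> restr (Ab i * Q i * Ab i) (range_space (Zb i))
              = restr (Q i * Ab i * Q i) (range_space (Zb i)))"
    proof -
      obtain N where N: "N > 0" "A ^\<^sub>m N = 1\<^sub>m n"
        using permutation_mat_finite_order[OF A_perm] by auto
      have Zb_sym: "transpose_mat (Zb i) = Zb i" if "i \<in> I" for i
        using that Zb_eq diag_unif_transpose unfolding I_def by simp
      have sym: "transpose_mat Z = Z"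
        unfolding Z_eq using bdiag_transpose[of m Zb d] bcong[of "\<lambda>i. transpose_mat (Zb i)" Zb] Zb Zb_sym
        unfolding I_def by simp
      note iso = braid_isometry[OF X_ds Zc sym idem Ac A_comm N(2,1)
          conjunct1[OF lhs] conjunct2[OF lhs]]
      have nn: "\<And>i j. i < n \<Longrightarrow> j < n \<Longrightarrow> 0 \<le> X $$ (i, j)"
        using X_ds by (auto simp: doubly_stochastic_def)
      have Z_entry: "Z $$ (offset d i + y, offset d i' + y') =
          (if i = i' \<and> y div k i = y' div k i then 1 / real (k i) else 0)"
        if "i \<in> I" "y < d i" "i' \<in> I" "y' < d i'" for i y i' y'
      proof -
        have "Z $$ (offset d i + y, offset d i' + y') = (if i = i' then Zb i $$ (y, y') else 0)"
          unfolding Z_eq by (rule bdiag_index) (use that Zb I_def in auto)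
        moreover have "Zb i $$ (y, y') = (if y div k i = y' div k i then 1 / real (k i) else 0)" if "i = i'"
          using diag_unif_index[of "k i" y "s i" y'] k_pos Zb_eq d_eq \<open>i \<in> I\<close> \<open>y < d i\<close> \<open>y' < d i'\<close> that
          unfolding I_def by simp
        ultimately show ?thesis by auto
      qed
      have cells: "Z $$ (c, a) = Z $$ (c, b)"
        if abc: "a < n" "b < n" "c < n" "Z $$ (a, b) \<noteq> 0" for a b c
      proof -
        obtain i y where a: "i \<in> I" "y < d i" "a = offset d i + y"
          using offset_cover[OF abc(1)[unfolded n]] unfolding I_def by blast
        obtain i' y' where b: "i' \<in> I" "y' < d i'" "b = offset d i' + y'"
          using offset_cover[OF abc(2)[unfolded n]] unfolding I_def by blast
        obtain i'' y'' where c: "i'' \<in> I" "y'' < d i''" "c = offset d i'' + y''"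
          using offset_cover[OF abc(3)[unfolded n]] unfolding I_def by blast
        have "i = i'" "y div k i = y' div k i"
          using abc(4) Z_entry[OF a(1,2) b(1,2)] unfolding a b by (auto split: if_splits)
        then show ?thesis
          unfolding a(3) b(3) c(3) Z_entry[OF c(1,2) a(1,2)] Z_entry[OF c(1,2) b(1,2)] by auto
      qed
      have off_less: "offset d i + y < n" if "i \<in> I" "y < d i" for i y
        unfolding n using that offset_less unfolding I_def by blast
      have X_entry: "X $$ (offset d i + y, offset d i' + y') = 1 / real (k i) \<and> i = i'"
        if "i \<in> I" "y < d i" "i' \<in> I" "y' < d i'"
          "X $$ (offset d i + y, offset d i' + y') \<noteq> 0" for i y i' y'
      proof -
        note e = isometry_entry[OF X_ds Zc sym iso cells off_less[OF that(1,2)] off_less[OF that(3,4)] that(5)]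
        have "X $$ (offset d i + y, offset d i' + y') = 1 / real (k i)"
          using e(1) Z_entry[OF that(1,2,1,2)] by simp
        moreover have "X $$ (offset d i + y, offset d i' + y') = 1 / real (k i')"
          using e(2) Z_entry[OF that(3,4,3,4)] by simp
        ultimately have "k i = k i'" using that k_pos unfolding I_def by simp
        then have "i = i'" using k_distinct that unfolding I_def by (auto dest: inj_onD)
        then show ?thesis using \<open>X $$ (offset d i + y, offset d i' + y') = 1 / real (k i)\<close> by simp
      qed
      \<comment> \<open>Distinct blocks have distinct cell sizes, so \<open>X\<close> vanishes off the diagonal blocks.\<close>
      define B where "B i = mat (d i) (d i) (\<lambda>(y, y'). X $$ (offset d i + y, offset d i + y'))" for i
      have B: "B i \<in> carrier_mat (d i) (d i)" for i unfolding B_def by simp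
      have tB: "transpose_mat (B i) \<in> carrier_mat (d i) (d i)" for i using B by simp
      have X_B: "X = bdiag m B"
      proof (rule bdiag_eqI[OF _ B])
        show "X \<in> carrier_mat (offset d (Suc m)) (offset d (Suc m))" using Xc n by simp
        fix i y i' y' assume *: "i \<in> {1..m}" "y < d i" "i' \<in> {1..m}" "y' < d i'"
        then show "X $$ (offset d i + y, offset d i' + y') = (if i = i' then B i $$ (y, y') else 0)"
          using X_entry[of i y i' y'] unfolding I_def by (auto simp: B_def)
      qed
      have tX_B: "transpose_mat X = bdiag m (\<lambda>i. transpose_mat (B i))"
        unfolding X_B by (rule bdiag_transpose[OF B])
      have blocks: "B i * Zb i = B i" "Zb i * B i = B i" "transpose_mat (B i) * B i = Zb i"
        "B i * transpose_mat (B i) = Zb i" if i: "i \<in> I" for i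
      proof -
        show "B i * Zb i = B i"
          by (rule binj[OF mults[OF B Zb] B _ i]) (use iso(1) bmult[OF B Zb] B Zb mults X_B Z_eq in auto)
        show "Zb i * B i = B i"
          by (rule binj[OF mults[OF Zb B] B _ i]) (use iso(2) bmult[OF Zb B] B Zb mults X_B Z_eq in auto)
        show "transpose_mat (B i) * B i = Zb i"
          by (rule binj[OF mults[OF tB B] Zb _ i]) (use iso(3) bmult[OF tB B] B tB mults X_B tX_B Z_eq in auto)
        show "B i * transpose_mat (B i) = Zb i"
          by (rule binj[OF mults[OF B tB] Zb _ i]) (use iso(4) bmult[OF B tB] B tB mults X_B tX_B Z_eq in auto)
      qed
      have "\<exists>Q. permutation_mat (d i) Q \<and> B i = Zb i * Q \<and> Q * Zb i = Zb i * Q" if i: "i \<in> I" for i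
      proof -
        have di: "d i = s i * k i" and ki: "0 < k i"
          and Zi: "Zb i = diag_block_mat (replicate (s i) (unif_mat (k i)))"
          using i d_eq k_pos Zb_eq unfolding I_def by auto
        show ?thesis
          unfolding di
        proof (rule cell_constant_eq_unif_perm[OF ki Zi _ _ _ blocks[OF i]])
          show "B i \<in> carrier_mat (s i * k i) (s i * k i)" using B[of i] di by simp
          fix y y' assume "y < s i * k i" "y' < s i * k i"
          then have y: "y < d i" "y' < d i" using di by auto
          show "0 \<le> B i $$ (y, y')"
            using y nn off_less[OF i] by (simp add: B_def)
          show "B i $$ (y, y') = 1 / real (k i)" if "B i $$ (y, y') \<noteq> 0"
            using X_entry[OF i y(1) i y(2)] that y by (simp add: B_def)
        qed
      qed
      then obtain Q where Q: "\<And>i. i \<in> I \<Longrightarrow>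
          permutation_mat (d i) (Q i) \<and> B i = Zb i * Q i \<and> Q i * Zb i = Zb i * Q i"
        by metis
      have "X = bdiag m (\<lambda>i. Zb i * Q i)" unfolding X_B by (rule bcong) (use Q in auto)
      moreover have "restr (Ab i * Q i * Ab i) (range_space (Zb i))
          = restr (Q i * Ab i * Q i) (range_space (Zb i))" if i: "i \<in> I" for i
      proof -
        have "Ab i * B i * Ab i = B i * Ab i * B i"
          using braid_bdiag_iff[OF B] lhs i unfolding X_B by blast
        then show ?thesis
          using braid_blocks_iff[OF Ab[OF i] Zb[OF i] perm_carrier Zb_idem[OF i] Ab_comm[OF i]] Q[OF i]
          by simp
      qed
      ultimately show ?thesis using Q by blast
    qed
  next
    assume "\<exists>Q. (\<forall>i\<in>I. permutation_mat (d i) (Q i)) \<and> X = bdiag m (\<lambda>i. Zb i * Q i)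
       \<and> (\<forall>i\<in>I. Q i * Zb i = Zb i * Q i
            \<and> restr (Ab i * Q i * Ab i) (range_space (Zb i))
              = restr (Q i * Ab i * Q i) (range_space (Zb i)))"
    then obtain Q where Qp: "\<And>i. i \<in> I \<Longrightarrow> permutation_mat (d i) (Q i)"
      and X_Q: "X = bdiag m (\<lambda>i. Zb i * Q i)"
      and QZ: "\<And>i. i \<in> I \<Longrightarrow> Q i * Zb i = Zb i * Q i"
      and res: "\<And>i. i \<in> I \<Longrightarrow> restr (Ab i * Q i * Ab i) (range_space (Zb i))
              = restr (Q i * Ab i * Q i) (range_space (Zb i))"
      by blast
    have Q: "Q i \<in> carrier_mat (d i) (d i)" if "i \<in> I" for i
      using perm_carrier Qp[OF that] .
    have "\<forall>i\<in>I. Ab i * (Zb i * Q i) * Ab i = Zb i * Q i * Ab i * (Zb i * Q i)"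
      using braid_blocks_iff[OF Ab Zb Q Zb_idem Ab_comm QZ] res by blast
    then have braid: "A * X * A = X * A * X"
      unfolding X_Q using braid_bdiag_iff[of "\<lambda>i. Zb i * Q i"] mults[OF Zb Q] by blast
    \<comment> \<open>Each \<open>Q i\<close> is invertible, so \<open>X = diag(Q) Z\<close> has the same kernel as \<open>Z\<close>.\<close>
    have "\<exists>L. L \<in> carrier_mat (d i) (d i) \<and> L * Q i = 1\<^sub>m (d i)" if i: "i \<in> I" for i
    proof -
      obtain N where "N > 0" "Q i ^\<^sub>m N = 1\<^sub>m (d i)"
        using permutation_mat_finite_order[OF Qp[OF i]] by auto
      then have "Q i ^\<^sub>m (N - 1) * Q i = 1\<^sub>m (d i)" by (cases N) auto
      then show ?thesis using pow_carrier_mat[OF Q[OF i]] by blast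
    qed
    then obtain L where L: "\<And>i. i \<in> I \<Longrightarrow> L i \<in> carrier_mat (d i) (d i)"
      and LQ: "\<And>i. i \<in> I \<Longrightarrow> L i * Q i = 1\<^sub>m (d i)"
      by metis
    have bL: "bdiag m L \<in> carrier_mat n n" and bQ: "bdiag m Q \<in> carrier_mat n n"
      unfolding n using L Q unfolding I_def by (auto intro: bdiag_carrier)
    have "bdiag m L * bdiag m Q = bdiag m (\<lambda>i. L i * Q i)"
      by (rule bmult) (simp_all add: L Q)
    also have "\<dots> = bdiag m (\<lambda>i. 1\<^sub>m (d i))" by (rule bcong) (simp add: LQ)
    finally have bLQ: "bdiag m L * bdiag m Q = 1\<^sub>m n" by (simp add: n bdiag_one)
    have "bdiag m Q * Z = bdiag m (\<lambda>i. Q i * Zb i)"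
      unfolding Z_eq by (rule bmult) (simp_all add: Q Zb)
    also have "\<dots> = X" unfolding X_Q by (rule bcong) (simp add: QZ)
    finally have X_QZ: "X = bdiag m Q * Z" by simp
    have "mat_kernel X = mat_kernel Z"
      unfolding X_QZ by (rule mat_kernel_mult_eq[OF Zc bQ bL bLQ])
    then show "A * X * A = X * A * X \<and> mat_kernel X = mat_kernel Z" using braid by simp
  qed
qed

end
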